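(* Let $E$ be a complex elliptic curve without complex multiplication (i.e. $\operatorname{End}(E)=\mathbb Z$), and let $g>1$ be an integer. Then every elliptic curve in $E^g$ is ordinary.
   Context: "Elliptic curve in" a complex torus $A$ means a one-dimensional complex subtorus of $A$ (so it passes through the origin). For a primitive vector $v=(v_1,\dots,v_g)\in\mathbb Z^g$ (i.e. $\gcd(v_1,\dots,v_g)=1$), let $E_v\subset E^g$ be the image of the embedding $E\to E^g$, $x\mapsto(v_1x,\dots,v_gx)$. The elliptic curves $E_v$, with $v\in\mathbb Z^g$ primitive, are called the ordinary elliptic curves in $E^g$. *)

theory Defs
  imports "HOL-Complex_Analysis.Complex_Analysis" "HOL-Algebra.Algebra"
begin

section \<open>One-dimensional complex tori\<close>

definition complex_lattice :: "complex set \<Rightarrow> bool" where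
  "complex_lattice \<Lambda> \<longleftrightarrow>
     (\<exists>\<omega>1 \<omega>2. \<omega>2 / \<omega>1 \<notin> \<real> \<and>
        \<Lambda> = {of_int m * \<omega>1 + of_int n * \<omega>2 | m n :: int. True})"

definition complex_add_group :: "complex monoid" where
  "complex_add_group = \<lparr>carrier = UNIV, mult = (+), one = 0\<rparr>"

text \<open>The torus \<open>\<complex> / \<Lambda>\<close>; it is a group in multiplicative notation, so that the multiple
  \<open>n \<cdot> x\<close> of a point is written \<open>x [^] n\<close>.\<close>

definition torus :: "complex set \<Rightarrow> complex set monoid" where
  "torus \<Lambda> = complex_add_group Mod \<Lambda>"

definition torus_proj :: "complex set \<Rightarrow> complex \<Rightarrow> complex set" where
  "torus_proj \<Lambda> z = \<Lambda> #>\<^bsub>complex_add_group\<^esub> z"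

text \<open>The charts of \<open>\<complex> / \<Lambda>\<close> are the local inverses of the projection \<open>\<complex> \<rightarrow> \<complex> / \<Lambda>\<close>, so a map is
  holomorphic iff around every point it is represented by a holomorphic function
  between open subsets of \<open>\<complex>\<close>. Continuity for the quotient topologies is implied.\<close>

definition torus_holomorphic ::
    "complex set \<Rightarrow> complex set \<Rightarrow> (complex set \<Rightarrow> complex set) \<Rightarrow> bool" where
  "torus_holomorphic M \<Lambda> f \<longleftrightarrow>
     (\<forall>z0. \<exists>U F. open U \<and> z0 \<in> U \<and> F holomorphic_on U \<and>
        (\<forall>z\<in>U. f (torus_proj M z) = torus_proj \<Lambda> (F z)))"

text \<open>Endomorphisms are represented by functions that are \<open>undefined\<close> outside the carrier, so
  that equality of functions is equality of endomorphisms.\<close>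

definition torus_End :: "complex set \<Rightarrow> (complex set \<Rightarrow> complex set) set" where
  "torus_End \<Lambda> =
     {f \<in> extensional (carrier (torus \<Lambda>)).
        f \<in> hom (torus \<Lambda>) (torus \<Lambda>) \<and> torus_holomorphic \<Lambda> \<Lambda> f}"

definition torus_multiple :: "complex set \<Rightarrow> int \<Rightarrow> complex set \<Rightarrow> complex set" where
  "torus_multiple \<Lambda> n = (\<lambda>x\<in>carrier (torus \<Lambda>). x [^]\<^bsub>torus \<Lambda>\<^esub> n)"

text \<open>\<open>End(E) = \<int>\<close>, in the sense that the canonical map \<open>\<int> \<rightarrow> End(E)\<close> is onto
  (it is always injective).\<close>

definition no_complex_multiplication :: "complex set \<Rightarrow> bool" where
  "no_complex_multiplication \<Lambda> \<longleftrightarrow> torus_End \<Lambda> = range (torus_multiple \<Lambda>)"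


section \<open>Elliptic curves in a power of an elliptic curve\<close>

definition torus_power :: "complex set \<Rightarrow> nat \<Rightarrow> (nat \<Rightarrow> complex set) monoid" where
  "torus_power \<Lambda> g = product_group {..<g} (\<lambda>_. torus \<Lambda>)"

text \<open>A map into a product of complex manifolds is holomorphic iff its components are.\<close>

definition torus_power_holomorphic ::
    "complex set \<Rightarrow> complex set \<Rightarrow> nat \<Rightarrow> (complex set \<Rightarrow> nat \<Rightarrow> complex set) \<Rightarrow> bool" where
  "torus_power_holomorphic M \<Lambda> g \<phi> \<longleftrightarrow>
     (\<forall>i<g. torus_holomorphic M \<Lambda> (\<lambda>x. \<phi> x i))"

text \<open>A one-dimensional complex subtorus is the image of a one-dimensional complex torus
  \<open>\<complex> / M\<close> under an injective holomorphic homomorphism. Such a map is automatically an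
  immersion and, \<open>\<complex> / M\<close> being compact, a closed embedding.\<close>

definition elliptic_curve_in_power ::
    "complex set \<Rightarrow> nat \<Rightarrow> (nat \<Rightarrow> complex set) set \<Rightarrow> bool" where
  "elliptic_curve_in_power \<Lambda> g S \<longleftrightarrow>
     (\<exists>M \<phi>. complex_lattice M \<and>
        \<phi> \<in> mon (torus M) (torus_power \<Lambda> g) \<and>
        torus_power_holomorphic M \<Lambda> g \<phi> \<and>
        S = \<phi> ` carrier (torus M))"

text \<open>Vectors in \<open>\<int>\<^sup>g\<close> are functions on \<open>nat\<close> of which only the values at
  \<open>0, \<dots>, g - 1\<close> matter.\<close>

definition primitive_vector :: "nat \<Rightarrow> (nat \<Rightarrow> int) \<Rightarrow> bool" where
  "primitive_vector g v \<longleftrightarrow> Gcd (v ` {..<g}) = 1"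

definition curve_of_vector ::
    "complex set \<Rightarrow> nat \<Rightarrow> (nat \<Rightarrow> int) \<Rightarrow> (nat \<Rightarrow> complex set) set" where
  "curve_of_vector \<Lambda> g v =
     (\<lambda>x. \<lambda>i\<in>{..<g}. x [^]\<^bsub>torus \<Lambda>\<^esub> v i) ` carrier (torus \<Lambda>)"

definition ordinary_elliptic_curve ::
    "complex set \<Rightarrow> nat \<Rightarrow> (nat \<Rightarrow> complex set) set \<Rightarrow> bool" where
  "ordinary_elliptic_curve \<Lambda> g S \<longleftrightarrow>
     (\<exists>v. primitive_vector g v \<and> S = curve_of_vector \<Lambda> g v)"

end

(* A homomorphism of complex tori that is holomorphic at 0 is induced by multiplication by a
   complex number, so an elliptic curve in E^g is the image of z |-> (a_0 z, ..., a_{g-1} z) for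
   some a with a_i M \<subseteq> \<Lambda>.  Some a_k is nonzero, and then a_k M has finite index in \<Lambda>: it contains
   N \<Lambda> for some N \<noteq> 0.  Hence each N a_i / a_k is an endomorphism of E, that is, an integer,
   so a is proportional to a primitive integral vector v, and rescaling z identifies the image
   with E_v. *)

theory Submission
  imports Defs
begin

section \<open>The additive group of complex numbers, rewritten to ordinary arithmetic\<close>

lemma complex_add_group_simps [simp]:
  "carrier complex_add_group = UNIV"
  "x \<otimes>\<^bsub>complex_add_group\<^esub> y = x + y"
  "\<one>\<^bsub>complex_add_group\<^esub> = 0"
  by (simp_all add: complex_add_group_def)

lemma comm_group_complex_add_group: "comm_group complex_add_group"
proof (rule comm_groupI)
  fix x assume "x \<in> carrier complex_add_group"
  show "\<exists>y\<in>carrier complex_add_group. y \<otimes>\<^bsub>complex_add_group\<^esub> x = \<one>\<^bsub>complex_add_group\<^esub>"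
    by (rule bexI[of _ "-x"]) auto
qed auto

lemma group_complex_add_group: "group complex_add_group"
  using comm_group_complex_add_group by (simp add: comm_group_def)

lemma inv_complex_add_group [simp]: "inv\<^bsub>complex_add_group\<^esub> x = - x"
  by (rule group.inv_equality[OF group_complex_add_group]) auto

lemma nat_pow_complex_add_group [simp]:
  "x [^]\<^bsub>complex_add_group\<^esub> (n::nat) = of_nat n * x"
  by (induction n) (auto simp: algebra_simps)

lemma int_pow_complex_add_group [simp]:
  "x [^]\<^bsub>complex_add_group\<^esub> (n::int) = of_int n * x"
  by (auto simp: int_pow_def2)

subsection \<open>Lattices\<close>

lemma complex_latticeE:
  assumes "complex_lattice \<Lambda>"
  obtains \<omega>1 \<omega>2 where "\<omega>2 / \<omega>1 \<notin> \<real>" "\<omega>1 \<noteq> 0"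
    "\<And>z. z \<in> \<Lambda> \<longleftrightarrow> (\<exists>m n. z = of_int m * \<omega>1 + of_int n * \<omega>2)"
proof -
  obtain \<omega>1 \<omega>2 where *: "\<omega>2 / \<omega>1 \<notin> \<real>"
    "\<Lambda> = {of_int m * \<omega>1 + of_int n * \<omega>2 | m n :: int. True}"
    using assms unfolding complex_lattice_def by blast
  \<comment> \<open>Division by zero yields 0, which is real, so a non-real quotient excludes
    \<open>\<omega>1 = 0\<close>.\<close>
  moreover have "\<omega>1 \<noteq> 0" using *(1) by auto
  ultimately show thesis using that by auto
qed

lemma complex_lattice_0:
  assumes "complex_lattice \<Lambda>"
  shows "0 \<in> \<Lambda>"
proof -
  obtain \<omega>1 \<omega>2 where L: "\<And>z. z \<in> \<Lambda> \<longleftrightarrow> (\<exists>m n. z = of_int m * \<omega>1 + of_int n * \<omega>2)"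
    using complex_latticeE[OF assms] by metis
  show ?thesis unfolding L by (rule exI[of _ 0], rule exI[of _ 0]) simp
qed

lemma complex_lattice_diff:
  assumes "complex_lattice \<Lambda>" "x \<in> \<Lambda>" "y \<in> \<Lambda>"
  shows "x - y \<in> \<Lambda>"
proof -
  obtain \<omega>1 \<omega>2 where L: "\<And>z. z \<in> \<Lambda> \<longleftrightarrow> (\<exists>m n. z = of_int m * \<omega>1 + of_int n * \<omega>2)"
    using complex_latticeE[OF assms(1)] by metis
  obtain a b c d where "x = of_int a * \<omega>1 + of_int b * \<omega>2" "y = of_int c * \<omega>1 + of_int d * \<omega>2"
    using assms(2,3) unfolding L by blast
  then have "x - y = of_int (a - c) * \<omega>1 + of_int (b - d) * \<omega>2"
    by (simp add: algebra_simps)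
  then show ?thesis unfolding L by blast
qed

lemma complex_lattice_uminus:
  assumes "complex_lattice \<Lambda>" "x \<in> \<Lambda>"
  shows "- x \<in> \<Lambda>"
  using complex_lattice_diff[OF assms(1) complex_lattice_0[OF assms(1)] assms(2)] by simp

lemma complex_lattice_add:
  assumes "complex_lattice \<Lambda>" "x \<in> \<Lambda>" "y \<in> \<Lambda>"
  shows "x + y \<in> \<Lambda>"
  using complex_lattice_diff[OF assms(1,2) complex_lattice_uminus[OF assms(1,3)]] by simp

text \<open>Up to the factor \<open>\<omega>1\<close>, a lattice point is
  \<open>m + n * \<tau>\<close> with \<open>\<tau>\<close> not real. If \<open>n\<close> is nonzero,
  its imaginary part has size at least that of \<open>Im \<tau>\<close>; if \<open>n = 0\<close>, it
  is an integer. This accounts for the minimum in \<open>\<delta>\<close>.\<close>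

lemma complex_lattice_discrete:
  assumes "complex_lattice \<Lambda>"
  obtains \<delta> where "\<delta> > 0" "\<And>z. z \<in> \<Lambda> \<Longrightarrow> norm z < \<delta> \<Longrightarrow> z = 0"
proof -
  obtain \<omega>1 \<omega>2 where w: "\<omega>2 / \<omega>1 \<notin> \<real>" "\<omega>1 \<noteq> 0"
    and L: "\<And>z. z \<in> \<Lambda> \<longleftrightarrow> (\<exists>m n. z = of_int m * \<omega>1 + of_int n * \<omega>2)"
    using complex_latticeE[OF assms] by metis
  define \<tau> where "\<tau> = \<omega>2 / \<omega>1"
  have Im: "Im \<tau> \<noteq> 0" using w(1) by (auto simp: \<tau>_def complex_is_Real_iff)
  define \<delta> where "\<delta> = norm \<omega>1 * min 1 \<bar>Im \<tau>\<bar>"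
  have pos: "\<delta> > 0" using w(2) Im by (simp add: \<delta>_def)
  have "z = 0" if "z \<in> \<Lambda>" and small: "norm z < \<delta>" for z
  proof -
    obtain m n where z: "z = of_int m * \<omega>1 + of_int n * \<omega>2" using \<open>z \<in> \<Lambda>\<close> L by blast
    have "z = \<omega>1 * (of_int m + of_int n * \<tau>)"
      using w(2) by (simp add: z \<tau>_def field_simps)
    then have "norm \<omega>1 * norm (of_int m + of_int n * \<tau>) < norm \<omega>1 * min 1 \<bar>Im \<tau>\<bar>"
      using small by (simp add: \<delta>_def norm_mult)
    then have lt: "norm (of_int m + of_int n * \<tau>) < min 1 \<bar>Im \<tau>\<bar>"
      using w(2) by simp
    have n0: "n = 0"
    proof (rule ccontr)
      assume "n \<noteq> 0"
      then have "1 \<le> \<bar>real_of_int n\<bar>" by linarith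
      then have "\<bar>Im \<tau>\<bar> \<le> \<bar>real_of_int n\<bar> * \<bar>Im \<tau>\<bar>"
        by (simp add: mult_le_cancel_right1)
      also have "\<dots> = \<bar>Im (of_int m + of_int n * \<tau>)\<bar>" by (simp add: abs_mult)
      also have "\<dots> \<le> norm (of_int m + of_int n * \<tau>)" by (rule abs_Im_le_cmod)
      finally show False using lt by linarith
    qed
    then have "norm (complex_of_int m) < 1" using lt by simp
    then have "m = 0" unfolding norm_of_int by linarith
    with n0 show "z = 0" by (simp add: z)
  qed
  with pos that show thesis by blast
qed

lemma complex_lattice_neq_UNIV:
  assumes "complex_lattice \<Lambda>"
  shows "\<Lambda> \<noteq> UNIV"
proof
  assume U: "\<Lambda> = UNIV"
  obtain \<delta> where d: "\<delta> > 0" "\<And>z. z \<in> \<Lambda> \<Longrightarrow> norm z < \<delta> \<Longrightarrow> z = 0"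
    using complex_lattice_discrete[OF assms] by metis
  \<comment> \<open>If every complex number were a lattice point, then so would be
    \<open>\<delta> / 2\<close>, which is too short to be nonzero.\<close>
  have "complex_of_real (\<delta> / 2) = 0"
    using d(1) by (intro d(2)) (simp_all add: U norm_of_real del: of_real_divide)
  with d(1) show False by simp
qed

text \<open>Serves to recover a multiplier from the map that it induces on the torus: if two
  multipliers induce the same map, their difference \<open>c\<close> satisfies this
  hypothesis.\<close>

lemma complex_mult_lattice_imp_0:
  assumes "complex_lattice \<Lambda>" and all: "\<And>z. c * z \<in> \<Lambda>"
  shows "c = 0"
proof (rule ccontr)
  assume "c \<noteq> 0"
  then have "z \<in> \<Lambda>" for z using all[of "z / c"] by simp
  with complex_lattice_neq_UNIV[OF assms(1)] show False by blast
qed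

text \<open>The multiplier \<open>N\<close> is the determinant of the basis of \<open>a M\<close> in terms of that of \<open>\<Lambda>\<close>.\<close>

lemma complex_lattice_finite_index:
  assumes "complex_lattice M" "complex_lattice \<Lambda>" "a \<noteq> 0"
    and sub: "\<And>m. m \<in> M \<Longrightarrow> a * m \<in> \<Lambda>"
  obtains N :: int where "N \<noteq> 0" "\<And>z. z \<in> \<Lambda> \<Longrightarrow> \<exists>m\<in>M. of_int N * z = a * m"
proof -
  obtain \<omega>1 \<omega>2 where w: "\<omega>2 / \<omega>1 \<notin> \<real>" "\<omega>1 \<noteq> 0"
    and M: "\<And>z. z \<in> M \<longleftrightarrow> (\<exists>m n. z = of_int m * \<omega>1 + of_int n * \<omega>2)"
    using complex_latticeE[OF assms(1)] by metis
  obtain \<eta>1 \<eta>2 where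
    L: "\<And>z. z \<in> \<Lambda> \<longleftrightarrow> (\<exists>m n. z = of_int m * \<eta>1 + of_int n * \<eta>2)"
    using complex_latticeE[OF assms(2)] by metis
  have "\<omega>1 \<in> M" unfolding M by (rule exI[of _ 1], rule exI[of _ 0]) simp
  moreover have "\<omega>2 \<in> M" unfolding M by (rule exI[of _ 0], rule exI[of _ 1]) simp
  ultimately have "a * \<omega>1 \<in> \<Lambda>" "a * \<omega>2 \<in> \<Lambda>" using sub by blast+
  then obtain p q r s where
    1: "a * \<omega>1 = of_int p * \<eta>1 + of_int q * \<eta>2" and
    2: "a * \<omega>2 = of_int r * \<eta>1 + of_int s * \<eta>2"
    unfolding L by blast
  define N where "N = p * s - q * r"
  \<comment> \<open>Cramer's rule: \<open>N1\<close> and \<open>N2\<close> apply the adjugate of the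
    integer matrix with rows \<open>(p, q)\<close> and \<open>(r, s)\<close> to equations
    \<open>1\<close> and \<open>2\<close>.\<close>
  have N1: "of_int N * \<eta>1 = a * (of_int s * \<omega>1 - of_int q * \<omega>2)"
  proof -
    have "a * (of_int s * \<omega>1 - of_int q * \<omega>2) = of_int s * (a * \<omega>1) - of_int q * (a * \<omega>2)"
      by (simp add: algebra_simps)
    also have "\<dots> = of_int N * \<eta>1" unfolding 1 2 N_def by (simp add: algebra_simps)
    finally show ?thesis ..
  qed
  have N2: "of_int N * \<eta>2 = a * (of_int p * \<omega>2 - of_int r * \<omega>1)"
  proof -
    have "a * (of_int p * \<omega>2 - of_int r * \<omega>1) = of_int p * (a * \<omega>2) - of_int r * (a * \<omega>1)"
      by (simp add: algebra_simps)
    also have "\<dots> = of_int N * \<eta>2" unfolding 1 2 N_def by (simp add: algebra_simps)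
    finally show ?thesis ..
  qed
  have indep: "k = 0 \<and> l = 0" if "of_int k * \<omega>2 = of_int l * \<omega>1" for k l :: int
  proof -
    have "k = 0"
    proof (rule ccontr)
      assume "k \<noteq> 0"
      then have "\<omega>2 / \<omega>1 = of_int l / of_int k" using that w(2) by (simp add: field_simps)
      with w(1) show False by (simp add: Reals_divide)
    qed
    with that w(2) show ?thesis by simp
  qed
  \<comment> \<open>With determinant 0, the adjugate relations become integral relations between
    \<open>\<omega>1\<close> and \<open>\<omega>2\<close>. By independence \<open>p = q = 0\<close>,
    so \<open>a * \<omega>1 = 0\<close>, which is impossible.\<close>
  have "N \<noteq> 0"
  proof
    assume "N = 0"
    then have "of_int s * \<omega>1 - of_int q * \<omega>2 = 0" "of_int p * \<omega>2 - of_int r * \<omega>1 = 0"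
      using N1 N2 assms(3) by simp_all
    then have "of_int q * \<omega>2 = of_int s * \<omega>1" "of_int p * \<omega>2 = of_int r * \<omega>1"
      unfolding right_minus_eq by metis+
    then have "p = 0" "q = 0" using indep by blast+
    with 1 assms(3) w(2) show False by simp
  qed
  moreover have "\<exists>m\<in>M. of_int N * z = a * m" if "z \<in> \<Lambda>" for z
  proof -
    obtain k l where z: "z = of_int k * \<eta>1 + of_int l * \<eta>2" using \<open>z \<in> \<Lambda>\<close> L by blast
    \<comment> \<open>The coefficients result from substituting \<open>N1\<close> and
      \<open>N2\<close> into \<open>N * z\<close>.\<close>
    let ?m = "of_int (k * s - l * r) * \<omega>1 + of_int (l * p - k * q) * \<omega>2"
    have "of_int N * z = of_int k * (of_int N * \<eta>1) + of_int l * (of_int N * \<eta>2)"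
      by (simp add: z algebra_simps)
    also have "\<dots> = a * ?m" unfolding N1 N2 by (simp add: algebra_simps)
    finally have "of_int N * z = a * ?m" .
    moreover have "?m \<in> M" unfolding M by blast
    ultimately show ?thesis by blast
  qed
  ultimately show thesis using that by blast
qed

subsection \<open>The group structure of a torus\<close>

lemma complex_lattice_normal:
  assumes "complex_lattice \<Lambda>"
  shows "\<Lambda> \<lhd> complex_add_group"
proof (rule comm_group.subgroup_imp_normal[OF comm_group_complex_add_group])
  show "subgroup \<Lambda> complex_add_group"
    by (rule group.subgroupI[OF group_complex_add_group])
      (use assms complex_lattice_0 in
        \<open>auto intro: complex_lattice_uminus complex_lattice_add\<close>)
qed

lemma group_torus:
  assumes "complex_lattice \<Lambda>"
  shows "group (torus \<Lambda>)"
  unfolding torus_def by (rule normal.factorgroup_is_group[OF complex_lattice_normal[OF assms]])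

lemma torus_proj_hom:
  assumes "complex_lattice \<Lambda>"
  shows "torus_proj \<Lambda> \<in> hom complex_add_group (torus \<Lambda>)"
  using normal.r_coset_hom_Mod[OF complex_lattice_normal[OF assms]]
  unfolding torus_def torus_proj_def .

lemma group_hom_torus_proj:
  assumes "complex_lattice \<Lambda>"
  shows "group_hom complex_add_group (torus \<Lambda>) (torus_proj \<Lambda>)"
  using group_complex_add_group group_torus[OF assms] torus_proj_hom[OF assms]
  by (simp add: group_hom_def group_hom_axioms_def)

lemma carrier_torus: "carrier (torus \<Lambda>) = range (torus_proj \<Lambda>)"
  by (auto simp: torus_def torus_proj_def FactGroup_def RCOSETS_def)

lemma mem_torus_proj: "w \<in> torus_proj \<Lambda> z \<longleftrightarrow> w - z \<in> \<Lambda>"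
proof
  assume "w - z \<in> \<Lambda>"
  then show "w \<in> torus_proj \<Lambda> z"
    unfolding torus_proj_def r_coset_def by (auto intro!: bexI[of _ "w - z"])
qed (auto simp: torus_proj_def r_coset_def)

lemma torus_proj_eq_iff:
  assumes "complex_lattice \<Lambda>"
  shows "torus_proj \<Lambda> z = torus_proj \<Lambda> w \<longleftrightarrow> z - w \<in> \<Lambda>"
proof
  assume "torus_proj \<Lambda> z = torus_proj \<Lambda> w"
  moreover have "z \<in> torus_proj \<Lambda> z"
    by (simp add: mem_torus_proj complex_lattice_0[OF assms])
  ultimately show "z - w \<in> \<Lambda>" by (simp add: mem_torus_proj)
next
  assume zw: "z - w \<in> \<Lambda>"
  show "torus_proj \<Lambda> z = torus_proj \<Lambda> w"
  proof (intro Set.set_eqI iffI)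
    fix x assume "x \<in> torus_proj \<Lambda> z"
    then show "x \<in> torus_proj \<Lambda> w"
      using complex_lattice_add[OF assms _ zw, of "x - z"] by (simp add: mem_torus_proj)
  next
    fix x assume "x \<in> torus_proj \<Lambda> w"
    then show "x \<in> torus_proj \<Lambda> z"
      using complex_lattice_diff[OF assms _ zw, of "x - w"] by (simp add: mem_torus_proj)
  qed
qed

lemma torus_proj_add:
  assumes "complex_lattice \<Lambda>"
  shows "torus_proj \<Lambda> z \<otimes>\<^bsub>torus \<Lambda>\<^esub> torus_proj \<Lambda> w = torus_proj \<Lambda> (z + w)"
  using hom_mult[OF torus_proj_hom[OF assms], of z w] by simp

lemma torus_proj_int_pow:
  assumes "complex_lattice \<Lambda>"
  shows "torus_proj \<Lambda> z [^]\<^bsub>torus \<Lambda>\<^esub> (n::int) = torus_proj \<Lambda> (of_int n * z)"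
  using group_hom.hom_int_pow[OF group_hom_torus_proj[OF assms], of z n] by simp

lemma hom_torus_proj_0:
  assumes "complex_lattice M" "complex_lattice \<Lambda>" "f \<in> hom (torus M) (torus \<Lambda>)"
  shows "f (torus_proj M 0) = torus_proj \<Lambda> 0"
  using hom_one[OF assms(3) group_torus[OF assms(1)] group_torus[OF assms(2)]]
    hom_one[OF torus_proj_hom group_complex_add_group group_torus] assms(1,2) by simp

lemma hom_torus_proj_add:
  assumes "complex_lattice M" "f \<in> hom (torus M) (torus \<Lambda>)"
  shows "f (torus_proj M (z + w)) = f (torus_proj M z) \<otimes>\<^bsub>torus \<Lambda>\<^esub> f (torus_proj M w)"
  using hom_mult[OF assms(2), of "torus_proj M z" "torus_proj M w"]
  by (simp add: torus_proj_add[OF assms(1)] carrier_torus)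

subsection \<open>Holomorphic homomorphisms\<close>

text \<open>A local representative \<open>F\<close> of the homomorphism with \<open>F 0 = 0\<close> satisfies \<open>F (2 z) = 2 F z\<close>
  for small \<open>z\<close>, since the difference is a small lattice point. So \<open>F z = 2\<^sup>n F (z / 2\<^sup>n)\<close>, which
  tends to \<open>F' 0 z\<close>.\<close>

lemma torus_holomorphic_hom_linear:
  assumes M: "complex_lattice M" and L: "complex_lattice \<Lambda>"
    and hom: "f \<in> hom (torus M) (torus \<Lambda>)" and hol: "torus_holomorphic M \<Lambda> f"
  obtains a where "\<And>z. f (torus_proj M z) = torus_proj \<Lambda> (a * z)"
proof -
  obtain U F0 where U: "open U" "0 \<in> U" and holF: "F0 holomorphic_on U"
    and F0: "\<And>z. z \<in> U \<Longrightarrow> f (torus_proj M z) = torus_proj \<Lambda> (F0 z)"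
    using hol unfolding torus_holomorphic_def by metis
  \<comment> \<open>Since \<open>f\<close> preserves the identity, \<open>F0 0\<close> is a lattice
    point; subtracting it leaves the represented map unchanged and achieves
    \<open>F 0 = 0\<close>.\<close>
  define F where "F z = F0 z - F0 0" for z
  have "torus_proj \<Lambda> (F0 0) = torus_proj \<Lambda> 0"
    using F0[OF U(2)] hom_torus_proj_0[OF M L hom] by simp
  then have "F0 0 \<in> \<Lambda>" using torus_proj_eq_iff[OF L] by simp
  then have FF0: "torus_proj \<Lambda> (F z) = torus_proj \<Lambda> (F0 z)" for z
    unfolding torus_proj_eq_iff[OF L] F_def using complex_lattice_uminus[OF L] by simp
  have F: "f (torus_proj M z) = torus_proj \<Lambda> (F z)" if "z \<in> U" for z
    using F0[OF that] FF0 by simp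
  have F_0: "F 0 = 0" by (simp add: F_def)
  have "F field_differentiable at 0"
    unfolding F_def using holomorphic_on_imp_differentiable_at[OF holF U]
    by (intro derivative_intros)
  then obtain a where a: "(F has_field_derivative a) (at 0)"
    unfolding field_differentiable_def by blast
  obtain \<delta> where d: "\<delta> > 0" "\<And>z. z \<in> \<Lambda> \<Longrightarrow> norm z < \<delta> \<Longrightarrow> z = 0"
    using complex_lattice_discrete[OF L] by metis
  have "isCont F 0" using a by (rule DERIV_isCont)
  then obtain e where e: "e > 0" "\<And>z. dist z 0 < e \<Longrightarrow> dist (F z) (F 0) < \<delta> / 3"
    using d(1) unfolding continuous_at_eps_delta by (metis divide_pos_pos zero_less_numeral)
  obtain e' where e': "e' > 0" "ball 0 e' \<subseteq> U"
    using U openE by blast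
  define r where "r = min e e'"
  have r: "r > 0" using e e' by (simp add: r_def)
  have inU: "z \<in> U" if "norm z < r" for z using that e'(2) by (auto simp: r_def)
  have small: "norm (F z) < \<delta> / 3" if "norm z < r" for z
    using e(2)[of z] that by (simp add: r_def F_0)
  have double: "F (2 * z) = 2 * F z" if "norm (2 * z) < r" for z
  proof -
    have zr: "norm z < r" using that norm_ge_zero[of z]
      unfolding norm_mult norm_numeral by linarith
    have "torus_proj \<Lambda> (F (2 * z)) = f (torus_proj M (z + z))"
      using F[OF inU[OF that]] unfolding mult_2 by (rule sym)
    also have "\<dots> = torus_proj \<Lambda> (2 * F z)"
      unfolding hom_torus_proj_add[OF M hom] F[OF inU[OF zr]] torus_proj_add[OF L] by simp
    finally have "F (2 * z) - 2 * F z \<in> \<Lambda>" using torus_proj_eq_iff[OF L] by simp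
    moreover have "norm (F (2 * z) - 2 * F z) < \<delta>"
    proof -
      have "norm (F (2 * z) - 2 * F z) \<le> norm (F (2 * z)) + norm (2 * F z)"
        by (rule norm_triangle_ineq4)
      also have "\<dots> < \<delta> / 3 + 2 * (\<delta> / 3)"
        using small[OF that] small[OF zr] unfolding norm_mult by simp
      finally show ?thesis by simp
    qed
    ultimately have "F (2 * z) - 2 * F z = 0" by (rule d(2))
    then show ?thesis by simp
  qed
  have small_pow: "norm (z / 2 ^ n) < r" if "norm z < r" for z :: complex and n
  proof -
    have "norm z / 2 ^ n \<le> norm z" by (simp add: divide_le_eq mult_le_cancel_left1)
    with that show ?thesis by (simp add: norm_divide norm_power)
  qed
  have iter: "F z = 2 ^ n * F (z / 2 ^ n)" if "norm z < r" for z n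
  proof (induction n)
    case (Suc n)
    have "F (2 * (z / 2 ^ Suc n)) = 2 * F (z / 2 ^ Suc n)"
      using small_pow[OF that, of n] by (intro double) simp
    with Suc show ?case by simp
  qed simp
  have lin: "F z = a * z" if z: "norm z < r" for z
  proof (cases "z = 0")
    case False
    have "((\<lambda>w. F w / w) \<longlongrightarrow> a) (at 0)"
      using a by (simp add: has_field_derivative_iff F_0)
    moreover have "filterlim (\<lambda>n. z / 2 ^ n) (at 0) sequentially"
    proof (rule filterlim_atI)
      have "(\<lambda>n. z * (1 / 2) ^ n) \<longlonglongrightarrow> z * 0"
        by (intro tendsto_intros LIMSEQ_power_zero) (simp add: norm_divide)
      then show "(\<lambda>n. z / 2 ^ n) \<longlonglongrightarrow> 0" by (simp add: power_one_over field_simps)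
    qed (use False in simp)
    ultimately have "(\<lambda>n. F (z / 2 ^ n) / (z / 2 ^ n)) \<longlonglongrightarrow> a"
      by (rule filterlim_compose)
    \<comment> \<open>By \<open>iter\<close> the difference quotients along \<open>z / 2 ^ n\<close>
      are constant, so their limit \<open>a\<close> is already the value
      \<open>F z / z\<close>.\<close>
    moreover have "(\<lambda>n. F (z / 2 ^ n) / (z / 2 ^ n)) = (\<lambda>n. F z / z)"
      using iter[OF z] by (simp add: fun_eq_iff field_simps)
    ultimately have "(\<lambda>n. F z / z) \<longlonglongrightarrow> a" by (simp only:)
    then have "F z / z = a" by (simp add: LIMSEQ_const_iff)
    with False show ?thesis by (simp add: field_simps)
  qed (simp add: F_0)
  \<comment> \<open>Additivity of \<open>f\<close> carries the formula from the small disc to the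
    whole plane by repeated doubling.\<close>
  have step: "f (torus_proj M (2 ^ n * z)) = torus_proj \<Lambda> (a * (2 ^ n * z))"
    if "norm z < r" for z n
  proof (induction n)
    case 0
    show ?case using F[OF inU[OF that]] lin[OF that] by simp
  next
    case (Suc n)
    have "f (torus_proj M (2 ^ Suc n * z)) = f (torus_proj M (2 ^ n * z + 2 ^ n * z))"
      by (simp add: algebra_simps)
    also have "\<dots> = torus_proj \<Lambda> (a * (2 ^ n * z) + a * (2 ^ n * z))"
      unfolding hom_torus_proj_add[OF M hom] Suc torus_proj_add[OF L] ..
    finally show ?case by (simp add: algebra_simps)
  qed
  have "f (torus_proj M z) = torus_proj \<Lambda> (a * z)" for z
  proof -
    obtain n where "norm z / r < 2 ^ n" using real_arch_pow[of 2 "norm z / r"] by auto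
    then have "norm (z / 2 ^ n) < r"
      using r by (simp add: norm_divide norm_power field_simps)
    from step[OF this, of n] show ?thesis by simp
  qed
  with that show thesis by blast
qed

text \<open>Multiplication by \<open>c\<close> descends to the quotient exactly because it maps
  \<open>\<Lambda>\<close> into itself.\<close>

lemma torus_End_mult:
  assumes L: "complex_lattice \<Lambda>" and c: "\<And>z. z \<in> \<Lambda> \<Longrightarrow> c * z \<in> \<Lambda>"
  obtains f where "f \<in> torus_End \<Lambda>" "\<And>z. f (torus_proj \<Lambda> z) = torus_proj \<Lambda> (c * z)"
proof -
  \<comment> \<open>A point of the torus is a coset, so a representative is chosen from it. The
    restriction to the carrier makes \<open>f\<close> extensional, as \<open>torus_End\<close>
    demands.\<close>
  define f where "f = (\<lambda>x\<in>carrier (torus \<Lambda>). torus_proj \<Lambda> (c * (SOME z. z \<in> x)))"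
  have proj_carrier: "torus_proj \<Lambda> z \<in> carrier (torus \<Lambda>)" for z
    by (simp add: carrier_torus)
  have f: "f (torus_proj \<Lambda> z) = torus_proj \<Lambda> (c * z)" for z
  proof -
    have "z \<in> torus_proj \<Lambda> z" by (simp add: mem_torus_proj complex_lattice_0[OF L])
    then have "(SOME w. w \<in> torus_proj \<Lambda> z) \<in> torus_proj \<Lambda> z" by (rule someI)
    then have "c * ((SOME w. w \<in> torus_proj \<Lambda> z) - z) \<in> \<Lambda>"
      by (intro c) (simp add: mem_torus_proj)
    then show ?thesis
      using torus_proj_eq_iff[OF L] by (simp add: f_def proj_carrier right_diff_distrib)
  qed
  have "f \<in> hom (torus \<Lambda>) (torus \<Lambda>)"
    by (auto simp: hom_def carrier_torus f torus_proj_add[OF L] ring_distribs)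
  moreover have "torus_holomorphic \<Lambda> \<Lambda> f"
    unfolding torus_holomorphic_def
    by (intro allI exI[of _ UNIV] exI[of _ "\<lambda>z. c * z"]) (auto simp: f intro: holomorphic_intros)
  ultimately have "f \<in> torus_End \<Lambda>" by (simp add: torus_End_def f_def)
  with f that show thesis by blast
qed

text \<open>The endomorphism induced by \<open>c\<close> must be multiplication by some integer
  \<open>n\<close>. Then \<open>(c - n) * z\<close> is a lattice point for every complex
  \<open>z\<close>, which forces \<open>c = n\<close>.\<close>

lemma no_complex_multiplication_imp_int:
  assumes L: "complex_lattice \<Lambda>" and "no_complex_multiplication \<Lambda>"
    and "\<And>z. z \<in> \<Lambda> \<Longrightarrow> c * z \<in> \<Lambda>"
  shows "c \<in> \<int>"
proof -
  obtain f where "f \<in> torus_End \<Lambda>" and f: "\<And>z. f (torus_proj \<Lambda> z) = torus_proj \<Lambda> (c * z)"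
    using torus_End_mult[OF L assms(3)] by metis
  then obtain n where n: "f = torus_multiple \<Lambda> n"
    using assms(2) unfolding no_complex_multiplication_def by blast
  have "(c - of_int n) * z \<in> \<Lambda>" for z
  proof -
    have "torus_proj \<Lambda> z \<in> carrier (torus \<Lambda>)" by (simp add: carrier_torus)
    then have "torus_proj \<Lambda> (c * z) = torus_proj \<Lambda> (of_int n * z)"
      using f[of z] by (simp add: n torus_multiple_def torus_proj_int_pow[OF L])
    then show ?thesis by (simp add: torus_proj_eq_iff[OF L] left_diff_distrib)
  qed
  then have "c = of_int n" using complex_mult_lattice_imp_0[OF L, of "c - of_int n"] by simp
  then show ?thesis by simp
qed

subsection \<open>Curves in powers\<close>

text \<open>Brings \<open>E_v\<close> into the form of a linear parametrization by the complex
  plane, to be compared with that of an arbitrary elliptic curve.\<close>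

lemma curve_of_vector_eq:
  assumes "complex_lattice \<Lambda>"
  shows "curve_of_vector \<Lambda> g v = range (\<lambda>z. \<lambda>i\<in>{..<g}. torus_proj \<Lambda> (of_int (v i) * z))"
  unfolding curve_of_vector_def carrier_torus image_image torus_proj_int_pow[OF assms] ..

text \<open>Each component of the embedding is a holomorphic homomorphism of tori, hence
  multiplication by some \<open>a i\<close>. Compatibility with the period lattices gives the
  inclusions, and injectivity makes some \<open>a i\<close> nonzero.\<close>

lemma elliptic_curve_in_power_linear:
  assumes L: "complex_lattice \<Lambda>" and "elliptic_curve_in_power \<Lambda> g S"
  obtains M a where "complex_lattice M" "\<exists>i<g. a i \<noteq> 0"
    "\<And>i m. i < g \<Longrightarrow> m \<in> M \<Longrightarrow> a i * m \<in> \<Lambda>"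
    "S = range (\<lambda>z. \<lambda>i\<in>{..<g}. torus_proj \<Lambda> (a i * z))"
proof -
  obtain M \<phi> where M: "complex_lattice M" and mon: "\<phi> \<in> mon (torus M) (torus_power \<Lambda> g)"
    and hol: "\<And>i. i < g \<Longrightarrow> torus_holomorphic M \<Lambda> (\<lambda>x. \<phi> x i)"
    and S: "S = \<phi> ` carrier (torus M)"
    using assms(2) unfolding elliptic_curve_in_power_def torus_power_holomorphic_def by blast
  have hom: "\<phi> \<in> hom (torus M) (torus_power \<Lambda> g)" and inj: "inj_on \<phi> (carrier (torus M))"
    using mon by (auto simp: mon_def)
  \<comment> \<open>Knowing the values outside the index range turns agreement of the components
    into equality of functions.\<close>
  have ext: "\<phi> (torus_proj M z) \<in> extensional {..<g}" for z
    using hom_carrier[OF hom] by (auto simp: torus_power_def carrier_torus PiE_def)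
  have homi: "(\<lambda>x. \<phi> x i) \<in> hom (torus M) (torus \<Lambda>)" if "i < g" for i
  proof (rule homI)
    fix x assume "x \<in> carrier (torus M)"
    then have "\<phi> x \<in> carrier (torus_power \<Lambda> g)" using hom_carrier[OF hom] by blast
    then show "\<phi> x i \<in> carrier (torus \<Lambda>)" using that by (auto simp: torus_power_def)
  next
    fix x y assume "x \<in> carrier (torus M)" "y \<in> carrier (torus M)"
    then have "\<phi> (x \<otimes>\<^bsub>torus M\<^esub> y) = \<phi> x \<otimes>\<^bsub>torus_power \<Lambda> g\<^esub> \<phi> y"
      by (rule hom_mult[OF hom])
    then show "\<phi> (x \<otimes>\<^bsub>torus M\<^esub> y) i = \<phi> x i \<otimes>\<^bsub>torus \<Lambda>\<^esub> \<phi> y i"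
      using that by (simp add: torus_power_def)
  qed
  have "\<exists>c. \<forall>z. \<phi> (torus_proj M z) i = torus_proj \<Lambda> (c * z)" if "i < g" for i
    using torus_holomorphic_hom_linear[OF M L homi[OF that] hol[OF that]] by metis
  then obtain a where a: "\<And>i z. i < g \<Longrightarrow> \<phi> (torus_proj M z) i = torus_proj \<Lambda> (a i * z)"
    by metis
  have \<phi>: "\<phi> (torus_proj M z) = (\<lambda>i\<in>{..<g}. torus_proj \<Lambda> (a i * z))" for z
    using ext[of z] a by (auto intro: extensionalityI)
  \<comment> \<open>Otherwise \<open>\<phi>\<close> is constant, and by injectivity the torus of
    \<open>M\<close> is a single point, so \<open>M\<close> is the whole plane.\<close>
  have "\<exists>i<g. a i \<noteq> 0"
  proof (rule ccontr)
    assume "\<not> (\<exists>i<g. a i \<noteq> 0)"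
    then have "\<phi> (torus_proj M z) = \<phi> (torus_proj M 0)" for z
      unfolding \<phi> by (auto intro!: restrict_ext)
    then have "torus_proj M z = torus_proj M 0" for z
      using inj by (auto dest: inj_onD simp: carrier_torus)
    then have "z \<in> M" for z using torus_proj_eq_iff[OF M, of z 0] by simp
    with complex_lattice_neq_UNIV[OF M] show False by blast
  qed
  moreover have "a i * m \<in> \<Lambda>" if "i < g" "m \<in> M" for i m
  proof -
    have "torus_proj M m = torus_proj M 0" using that(2) by (simp add: torus_proj_eq_iff[OF M])
    then have "torus_proj \<Lambda> (a i * m) = torus_proj \<Lambda> (a i * 0)"
      using a[OF that(1)] by metis
    then show ?thesis by (simp add: torus_proj_eq_iff[OF L])
  qed
  moreover have "S = range (\<lambda>z. \<lambda>i\<in>{..<g}. torus_proj \<Lambda> (a i * z))"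
    unfolding S carrier_torus image_image \<phi> ..
  ultimately show thesis using that M by blast
qed

text \<open>Divide by the gcd \<open>d\<close> of the entries, which is nonzero because
  \<open>n k\<close> is.\<close>

lemma primitive_vector_exists:
  fixes n :: "nat \<Rightarrow> int"
  assumes "k < g" "n k \<noteq> 0"
  obtains d v where "d \<noteq> 0" "primitive_vector g v" "\<And>i. i < g \<Longrightarrow> n i = d * v i"
proof -
  define d where "d = Gcd (n ` {..<g})"
  define v where "v i = n i div d" for i
  have d0: "d \<noteq> 0" using assms by (auto simp: d_def Gcd_0_iff)
  have nv: "n i = d * v i" if "i < g" for i
    using that by (simp add: v_def d_def)
  have "(\<lambda>i. d * v i) ` {..<g} = n ` {..<g}" using nv by auto
  then have "Gcd ((*) d ` v ` {..<g}) = d" by (simp add: image_image d_def)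
  then have "\<bar>d * Gcd (v ` {..<g})\<bar> = d" unfolding Gcd_mult by simp
  moreover have "d * Gcd (v ` {..<g}) \<ge> 0"
    unfolding d_def by (intro mult_nonneg_nonneg) simp_all
  ultimately have "d * Gcd (v ` {..<g}) = d * 1" by linarith
  then have "Gcd (v ` {..<g}) = 1" using d0 mult_left_cancel by blast
  then have "primitive_vector g v" by (simp add: primitive_vector_def)
  with d0 nv that show thesis by blast
qed

theorem proposition3p2:
  fixes \<Lambda> :: "complex set" and g :: nat and S :: "(nat \<Rightarrow> complex set) set"
  assumes "complex_lattice \<Lambda>"
    and "no_complex_multiplication \<Lambda>"
    and "g > 1"
    and "elliptic_curve_in_power \<Lambda> g S"
  shows "ordinary_elliptic_curve \<Lambda> g S"
proof -
  note L = assms(1)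
  obtain M a where M: "complex_lattice M" and "\<exists>i<g. a i \<noteq> 0"
    and aM: "\<And>i m. i < g \<Longrightarrow> m \<in> M \<Longrightarrow> a i * m \<in> \<Lambda>"
    and S: "S = range (\<lambda>z. \<lambda>i\<in>{..<g}. torus_proj \<Lambda> (a i * z))"
    using elliptic_curve_in_power_linear[OF L assms(4)] by metis
  then obtain k where k: "k < g" "a k \<noteq> 0" by blast
  obtain N :: int where N: "N \<noteq> 0" "\<And>z. z \<in> \<Lambda> \<Longrightarrow> \<exists>m\<in>M. of_int N * z = a k * m"
    using complex_lattice_finite_index[OF M L k(2) aM[OF k(1)]] by metis
  have "of_int N * a i / a k \<in> \<int>" if "i < g" for i
  proof (rule no_complex_multiplication_imp_int[OF L assms(2)])
    fix z assume "z \<in> \<Lambda>"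
    then obtain m where "m \<in> M" "of_int N * z = a k * m" using N(2) by blast
    \<comment> \<open>Substituting \<open>N * z = a k * m\<close> cancels \<open>a k\<close>, and
      \<open>a i * m\<close> is in \<open>\<Lambda>\<close> because \<open>m\<close> is a period in
      \<open>M\<close>.\<close>
    moreover from this have "of_int N * a i / a k * z = a i * m"
      using k(2) by (simp add: field_simps)
    ultimately show "of_int N * a i / a k * z \<in> \<Lambda>" using aM[OF that] by simp
  qed
  then have "\<forall>i. \<exists>n. i < g \<longrightarrow> of_int N * a i / a k = of_int n" by (meson Ints_cases)
  then obtain n where n: "\<And>i. i < g \<Longrightarrow> of_int N * a i / a k = of_int (n i)" by metis
  \<comment> \<open>At index \<open>k\<close> the quotient is \<open>N\<close> itself.\<close>
  have "n k \<noteq> 0" using n[OF k(1)] N(1) k(2) by auto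
  then obtain d v where d: "d \<noteq> 0" and v: "primitive_vector g v"
    and nv: "\<And>i. i < g \<Longrightarrow> n i = d * v i"
    using primitive_vector_exists[OF k(1), of n] by metis
  \<comment> \<open>Solving \<open>N * a i / a k = d * v i\<close> for \<open>a i\<close> exhibits
    \<open>\<alpha>\<close> as the common factor of proportionality.\<close>
  define \<alpha> where "\<alpha> = a k * of_int d / of_int N"
  have \<alpha>: "\<alpha> \<noteq> 0" using k(2) d N(1) by (simp add: \<alpha>_def)
  have a: "a i = of_int (v i) * \<alpha>" if "i < g" for i
    using n[OF that] nv[OF that] N(1) k(2) by (simp add: \<alpha>_def field_simps)
  let ?\<psi> = "\<lambda>z. \<lambda>i\<in>{..<g}. torus_proj \<Lambda> (of_int (v i) * z)"
  have "(\<lambda>i\<in>{..<g}. torus_proj \<Lambda> (a i * z)) = ?\<psi> (\<alpha> * z)" for z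
    using a by (auto simp: mult.assoc intro!: restrict_ext)
  \<comment> \<open>Scaling by the nonzero \<open>\<alpha>\<close> is onto the plane, so both
    parametrizations have the same image.\<close>
  then have "S = ?\<psi> ` range ((*) \<alpha>)" unfolding S by (simp add: image_image)
  also have "range ((*) \<alpha>) = UNIV"
    by (rule surjI[of _ "\<lambda>z. z / \<alpha>"]) (simp add: \<alpha>)
  also have "range ?\<psi> = curve_of_vector \<Lambda> g v" by (rule curve_of_vector_eq[OF L, symmetric])
  finally show ?thesis using v unfolding ordinary_elliptic_curve_def by blast
qed

end
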